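(* Every perfectly normal mapping $f:X\to Y$ is hereditarily normal.
   Context: All spaces are topological spaces; mappings $f:X\to Y$ are continuous; neighborhoods are open; functions are real-valued and not necessarily continuous. For a bounded $\varphi:X\to\mathbb R$ and $x\in X$, $\mathrm{osc}_\varphi(x)=\inf\{\sup_{z\in U}|\varphi(x)-\varphi(z)| : U \text{ an open neighborhood of } x\}$; for non-empty $A\subset X$, $\mathrm{osc}_\varphi(A)=\sup_{x\in A}\mathrm{osc}_\varphi(x)$, and $\mathrm{osc}_\varphi(\varnothing)=0$. A family of functions $\{\varphi_n:X\to[0,1]\}_{n\in\mathbb N}$ is $f$-equicontinuous at $y\in Y$ if for any $\varepsilon>0$ there is a neighborhood $\mathcal{O}y$ of $y$ with $\mathrm{osc}_{\varphi_n}(f^{-1}\mathcal{O}y)<\varepsilon$ for every $n\in\mathbb N$. A mapping $f:X\to Y$ is perfectly normal if for any open subset $O\subset X$ and any point $y\in Y$ there exist a neighborhood $\mathcal{O}y$ of $y$ and a countable family of functions $\{\varphi_l:X\to[0,1]\mid l\in\mathbb N\}$, $f$-equicontinuous at $y$, such that (1) $O\cap f^{-1}\mathcal{O}y=\bigcup_{l\in\mathbb N}(\varphi_l^{-1}(1)\cap f^{-1}\mathcal{O}y)$; (2) $f^{-1}\mathcal{O}y\setminus O\subset\varphi_l^{-1}(0)\cap f^{-1}\mathcal{O}y$ for all $l\in\mathbb N$. A mapping $f:X\to Y$ is prenormal if for any two disjoint closed subsets $A,B$ of $X$ every point $y\in Y$ has a neighborhood $\mathcal{O}y$ such that $A\cap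 f^{-1}\mathcal{O}y$ and $B\cap f^{-1}\mathcal{O}y$ have disjoint neighborhoods in $f^{-1}\mathcal{O}y$. The mapping $f$ is normal if for every open $\mathcal{O}\subset Y$ the restriction $f_{\mathcal{O}}: f^{-1}\mathcal{O}\to\mathcal{O}$ is prenormal. It is hereditarily normal if for every subset $X_0\subset X$ the submapping $f|_{X_0}:X_0\to Y$ (with $X_0$ in the subspace topology) is normal. *)

theory Defs
  imports "HOL-Analysis.Analysis"
begin

abbreviation pre :: "'a topology \<Rightarrow> ('a \<Rightarrow> 'b) \<Rightarrow> 'b set \<Rightarrow> 'a set" where
  "pre X f V \<equiv> {x \<in> topspace X. f x \<in> V}"

text \<open>The real-valued infimum and suprema below are the intended ones for functions bounded on
  \<open>X\<close> and points of \<open>X\<close>: then every set involved is nonempty and bounded. They are only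
  applied to functions with values in \<open>[0,1]\<close>.\<close>

definition osc_at :: "'a topology \<Rightarrow> ('a \<Rightarrow> real) \<Rightarrow> 'a \<Rightarrow> real" where
  "osc_at X \<phi> x = (INF U \<in> {U. openin X U \<and> x \<in> U}. SUP z \<in> U. \<bar>\<phi> x - \<phi> z\<bar>)"

definition osc_on :: "'a topology \<Rightarrow> ('a \<Rightarrow> real) \<Rightarrow> 'a set \<Rightarrow> real" where
  "osc_on X \<phi> A = (if A = {} then 0 else (SUP x \<in> A. osc_at X \<phi> x))"

definition equicontinuous_over ::
  "'a topology \<Rightarrow> 'b topology \<Rightarrow> ('a \<Rightarrow> 'b) \<Rightarrow> (nat \<Rightarrow> 'a \<Rightarrow> real) \<Rightarrow> 'b \<Rightarrow> bool" where
  "equicontinuous_over X Y f \<phi> y \<longleftrightarrow>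
     (\<forall>\<epsilon>>0. \<exists>V. openin Y V \<and> y \<in> V \<and> (\<forall>n. osc_on X (\<phi> n) (pre X f V) < \<epsilon>))"

text \<open>A mapping is a continuous map between the given topologies, so continuity is part of each
  of the following notions. The functions \<open>\<phi> l\<close> are not required to be continuous.\<close>

definition perfectly_normal_map :: "'a topology \<Rightarrow> 'b topology \<Rightarrow> ('a \<Rightarrow> 'b) \<Rightarrow> bool" where
  "perfectly_normal_map X Y f \<longleftrightarrow> continuous_map X Y f \<and>
     (\<forall>G y. openin X G \<and> y \<in> topspace Y \<longrightarrow>
       (\<exists>V \<phi>. openin Y V \<and> y \<in> V \<and>
          (\<forall>l. \<phi> l \<in> topspace X \<rightarrow> {0..1}) \<and>
          equicontinuous_over X Y f \<phi> y \<and>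
          G \<inter> pre X f V = (\<Union>l. pre X (\<phi> l) {1} \<inter> pre X f V) \<and>
          (\<forall>l. pre X f V - G \<subseteq> pre X (\<phi> l) {0} \<inter> pre X f V)))"

definition prenormal_map :: "'a topology \<Rightarrow> 'b topology \<Rightarrow> ('a \<Rightarrow> 'b) \<Rightarrow> bool" where
  "prenormal_map X Y f \<longleftrightarrow> continuous_map X Y f \<and>
     (\<forall>A B. closedin X A \<and> closedin X B \<and> disjnt A B \<longrightarrow>
       (\<forall>y \<in> topspace Y. \<exists>V. openin Y V \<and> y \<in> V \<and>
          (\<exists>G H. openin (subtopology X (pre X f V)) G \<and>
                 openin (subtopology X (pre X f V)) H \<and>
                 A \<inter> pre X f V \<subseteq> G \<and> B \<inter> pre X f V \<subseteq> H \<and> disjnt G H)))"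

definition normal_map :: "'a topology \<Rightarrow> 'b topology \<Rightarrow> ('a \<Rightarrow> 'b) \<Rightarrow> bool" where
  "normal_map X Y f \<longleftrightarrow> continuous_map X Y f \<and>
     (\<forall>W. openin Y W \<longrightarrow> prenormal_map (subtopology X (pre X f W)) (subtopology Y W) f)"

definition hereditarily_normal_map :: "'a topology \<Rightarrow> 'b topology \<Rightarrow> ('a \<Rightarrow> 'b) \<Rightarrow> bool" where
  "hereditarily_normal_map X Y f \<longleftrightarrow> continuous_map X Y f \<and>
     (\<forall>S \<subseteq> topspace X. normal_map (subtopology X S) Y f)"

end

theory Submission
  imports Defs
begin

text \<open>The hypothesis on open sets of the total space yields more than separation of closed sets:
  it separates any two sets \<open>A\<close> and \<open>B\<close> neither of which meets the closure of the other, locally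
  over each point \<open>y\<close> of the base. Disjoint relatively closed subsets of a subspace are of this
  kind in the whole space, so hereditary normality follows.

  To separate such sets, apply perfect normality to the complement of the closure of \<open>B\<close>, an open
  set \<open>G\<close> containing \<open>A\<close>. The functions \<open>\<phi> l\<close> need not be continuous, but over a
  neighbourhood of \<open>y\<close> they all have oscillation below a fixed constant less than one half. This
  suffices to put an open set \<open>U l\<close> between the set where \<open>\<phi> l = 1\<close> and the set where
  \<open>\<phi> l\<close> is large, and the closure of \<open>U l\<close> still avoids the zeros of \<open>\<phi> l\<close>. Thus
  \<open>A\<close> has, over that neighbourhood, a countable cover by open sets with closures missing \<open>B\<close>
  (\<open>perfectly_normal_map_open_cover\<close>). By symmetry \<open>B\<close> has such a cover with respect to
  \<open>A\<close>, and the classical argument that alternately removes the closures of the earlier members of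
  the other cover produces disjoint neighbourhoods (\<open>countable_covers_separate\<close>).\<close>

text \<open>The real supremum and infimum defining the oscillation are informative only because
  the function is bounded; this bound makes the supremum over a set dominate the pointwise
  oscillations.\<close>

lemma osc_at_le_1:
  assumes \<phi>: "\<phi> \<in> topspace X \<rightarrow> {0..1}" and x: "x \<in> topspace X"
  shows "osc_at X \<phi> x \<le> 1"
proof -
  have diff: "\<bar>\<phi> x - \<phi> z\<bar> \<le> 1" if "z \<in> topspace X" for z
    using Pi_mem[OF \<phi> x] Pi_mem[OF \<phi> that] by (auto simp: abs_le_iff)
  have nonneg: "0 \<le> (SUP z\<in>U. \<bar>\<phi> x - \<phi> z\<bar>)" if "openin X U" "x \<in> U" for U
  proof -
    have "bdd_above ((\<lambda>z. \<bar>\<phi> x - \<phi> z\<bar>) ` U)"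
      using diff openin_subset[OF that(1)] by (intro bdd_aboveI2[where M=1]) auto
    from cSUP_upper[OF that(2) this] show ?thesis by simp
  qed
  have "osc_at X \<phi> x \<le> (SUP z\<in>topspace X. \<bar>\<phi> x - \<phi> z\<bar>)"
    unfolding osc_at_def
    using x nonneg by (intro cINF_lower bdd_belowI2[where m=0]) auto
  also have "\<dots> \<le> 1"
    using x diff by (intro cSUP_least) auto
  finally show ?thesis .
qed

lemma osc_on_less_imp_nbhd:
  assumes \<phi>: "\<phi> \<in> topspace X \<rightarrow> {0..1}" and A: "A \<subseteq> topspace X" and x: "x \<in> A"
    and less: "osc_on X \<phi> A < \<epsilon>"
  obtains N where "openin X N" "x \<in> N" "\<And>z. z \<in> N \<Longrightarrow> \<bar>\<phi> x - \<phi> z\<bar> < \<epsilon>"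
proof -
  have "osc_at X \<phi> x \<le> (SUP x\<in>A. osc_at X \<phi> x)"
    using A x osc_at_le_1[OF \<phi>] by (intro cSUP_upper bdd_aboveI2[where M=1]) auto
  also have "\<dots> < \<epsilon>"
    using less x by (auto simp: osc_on_def split: if_splits)
  finally have "(INF U \<in> {U. openin X U \<and> x \<in> U}. SUP z \<in> U. \<bar>\<phi> x - \<phi> z\<bar>) < \<epsilon>"
    by (simp add: osc_at_def)
  moreover have "topspace X \<in> {U. openin X U \<and> x \<in> U}"
    using A x by auto
  ultimately obtain N where N: "openin X N" "x \<in> N" and sup: "(SUP z\<in>N. \<bar>\<phi> x - \<phi> z\<bar>) < \<epsilon>"
    using cInf_lessD[of "(\<lambda>U. SUP z \<in> U. \<bar>\<phi> x - \<phi> z\<bar>) ` {U. openin X U \<and> x \<in> U}" \<epsilon>] by blast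
  have diff: "\<bar>\<phi> x - \<phi> z\<bar> \<le> 1" if "z \<in> N" for z
  proof -
    have "x \<in> topspace X" "z \<in> topspace X"
      using A x that openin_subset[OF N(1)] by auto
    then show ?thesis
      using Pi_mem[OF \<phi>, of x] Pi_mem[OF \<phi>, of z] by (auto simp: abs_le_iff)
  qed
  have "\<bar>\<phi> x - \<phi> z\<bar> < \<epsilon>" if "z \<in> N" for z
  proof -
    have "\<bar>\<phi> x - \<phi> z\<bar> \<le> (SUP z\<in>N. \<bar>\<phi> x - \<phi> z\<bar>)"
      using that diff by (intro cSUP_upper bdd_aboveI2[where M=1]) auto
    with sup show ?thesis by simp
  qed
  with N that show ?thesis by blast
qed

text \<open>A map version of the fact that in a perfectly normal space every open set is a countable
  union of open sets whose closures it contains. Only one value of the oscillation bound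
  is used: over a common neighbourhood all \<open>\<phi> l\<close> oscillate by less than \<open>1/4\<close>, so a point where
  \<open>\<phi> l = 1\<close> is interior to the set where \<open>\<phi> l > 3/4\<close>, while a point where \<open>\<phi> l = 0\<close>
  has a neighbourhood on which \<open>\<phi> l < 1/4\<close>.\<close>

lemma perfectly_normal_map_open_cover:
  assumes f: "perfectly_normal_map X Y f" and G: "openin X G" and y: "y \<in> topspace Y"
  obtains V U where "openin Y V" "y \<in> V" "\<And>l::nat. openin X (U l)"
    "G \<inter> pre X f V \<subseteq> (\<Union>l. U l)" "\<And>l. X closure_of U l \<inter> pre X f V \<subseteq> G"
proof -
  obtain V1 \<phi> where V1: "openin Y V1" "y \<in> V1"
    and \<phi>: "\<forall>l::nat. \<phi> l \<in> topspace X \<rightarrow> {0..1}"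
    and equi: "equicontinuous_over X Y f \<phi> y"
    and one: "G \<inter> pre X f V1 = (\<Union>l. pre X (\<phi> l) {1} \<inter> pre X f V1)"
    and zero: "\<forall>l. pre X f V1 - G \<subseteq> pre X (\<phi> l) {0} \<inter> pre X f V1"
    using f[unfolded perfectly_normal_map_def, THEN conjunct2, rule_format, OF conjI, OF G y]
    by (elim exE conjE) (rule that)
  obtain V2 where V2: "openin Y V2" "y \<in> V2" and osc: "\<And>l. osc_on X (\<phi> l) (pre X f V2) < 1/4"
    using equi unfolding equicontinuous_over_def by (metis zero_less_divide_1_iff zero_less_numeral)
  define U where "U l = X interior_of {x \<in> topspace X. \<phi> l x > 3/4}" for l
  have nbhd: "\<exists>N. openin X N \<and> x \<in> N \<and> (\<forall>z\<in>N. \<bar>\<phi> l x - \<phi> l z\<bar> < 1/4)"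
    if "x \<in> pre X f V2" for x l
    by (rule osc_on_less_imp_nbhd[OF \<phi>[rule_format, of l] _ that osc[of l]]) auto
  show ?thesis
  proof
    show "openin Y (V1 \<inter> V2)" "y \<in> V1 \<inter> V2"
      using V1 V2 by auto
    show "openin X (U l)" for l
      by (simp add: U_def)
    show "G \<inter> pre X f (V1 \<inter> V2) \<subseteq> (\<Union>l. U l)"
    proof
      fix x assume x: "x \<in> G \<inter> pre X f (V1 \<inter> V2)"
      then obtain l where l: "\<phi> l x = 1" using one by blast
      obtain N where N: "openin X N" "x \<in> N" "\<forall>z\<in>N. \<bar>\<phi> l x - \<phi> l z\<bar> < 1/4"
        using nbhd[of x l] x by blast
      have "\<phi> l z > 3/4" if "z \<in> N" for z
        using bspec[OF N(3) that] l by linarith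
      then have "N \<subseteq> {x \<in> topspace X. \<phi> l x > 3/4}"
        using openin_subset[OF N(1)] by auto
      then have "x \<in> U l"
        using N by (auto simp: U_def interior_of_def)
      then show "x \<in> (\<Union>l. U l)" by blast
    qed
    show "X closure_of U l \<inter> pre X f (V1 \<inter> V2) \<subseteq> G" for l
    proof (rule subsetI, rule ccontr)
      fix z assume z: "z \<in> X closure_of U l \<inter> pre X f (V1 \<inter> V2)" and "z \<notin> G"
      then have 0: "\<phi> l z = 0" using zero by blast
      obtain N where N: "openin X N" "z \<in> N" "\<forall>w\<in>N. \<bar>\<phi> l z - \<phi> l w\<bar> < 1/4"
        using nbhd[of z l] z by blast
      obtain w where w: "w \<in> U l" "w \<in> N"
        using z N(1,2) by (auto simp: in_closure_of)
      have "\<phi> l w > 3/4"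
        using w(1) interior_of_subset[of X "{x \<in> topspace X. \<phi> l x > 3/4}"] by (auto simp: U_def)
      with bspec[OF N(3) w(2)] 0 show False by linarith
    qed
  qed
qed

text \<open>The interleaving used in the proof that regular Lindelof spaces are normal. A member of
  one cover loses the closures of those members of the other cover with index at most its own;
  of two members, the one with the larger index therefore misses the other.\<close>

lemma countable_covers_separate:
  fixes U T :: "nat \<Rightarrow> 'a set"
  assumes U: "\<And>l. openin X (U l)" and T: "\<And>l. openin X (T l)"
    and A: "A \<subseteq> (\<Union>l. U l)" and B: "B \<subseteq> (\<Union>l. T l)"
    and UB: "\<And>l. disjnt (X closure_of U l) B" and TA: "\<And>l. disjnt (X closure_of T l) A"
  obtains G H where "openin X G" "openin X H" "A \<subseteq> G" "B \<subseteq> H" "disjnt G H"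
proof
  let ?G = "\<Union>l. U l - (\<Union>k\<le>l. X closure_of T k)"
  let ?H = "\<Union>l. T l - (\<Union>k\<le>l. X closure_of U k)"
  show "openin X ?G" "openin X ?H"
    using U T by (intro openin_Union openin_diff closedin_Union; auto)+
  show "A \<subseteq> ?G"
  proof
    fix x assume "x \<in> A"
    moreover from this have "x \<notin> X closure_of T k" for k
      using TA[of k] by (auto simp: disjnt_iff)
    ultimately show "x \<in> ?G" using A by auto
  qed
  show "B \<subseteq> ?H"
  proof
    fix x assume "x \<in> B"
    moreover from this have "x \<notin> X closure_of U k" for k
      using UB[of k] by (auto simp: disjnt_iff)
    ultimately show "x \<in> ?H" using B by auto
  qed
  have "U l \<subseteq> X closure_of U l" "T l \<subseteq> X closure_of T l" for l
    by (simp_all add: U T closure_of_subset openin_subset)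
  then have "x \<in> X closure_of U l" "x \<in> X closure_of T m" if "x \<in> U l" "x \<in> T m" for x l m
    using that by auto
  then show "disjnt ?G ?H"
    unfolding disjnt_iff by clarsimp (metis atMost_iff nat_le_linear)
qed

text \<open>Separatedness, unlike being closed and disjoint, does not depend on the subspace in which it
  is tested; this is what makes the conclusion inherited by submappings. The covers from
  \<open>perfectly_normal_map_open_cover\<close> have closures controlled only over a neighbourhood
  of \<open>y\<close>, so they are used for the parts of \<open>A\<close> and \<open>B\<close> over that neighbourhood.\<close>

lemma perfectly_normal_map_separatedin:
  assumes f: "perfectly_normal_map X Y f" and AB: "separatedin X A B" and y: "y \<in> topspace Y"
  obtains V G H where "openin Y V" "y \<in> V" "openin X G" "openin X H"
    "A \<inter> pre X f V \<subseteq> G" "B \<inter> pre X f V \<subseteq> H" "disjnt G H"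
proof -
  have sub: "A \<subseteq> topspace X - X closure_of B" "B \<subseteq> topspace X - X closure_of A"
    using AB by (auto simp: separatedin_def)
  have cl: "A \<subseteq> X closure_of A" "B \<subseteq> X closure_of B"
    using AB by (auto simp: separatedin_def closure_of_subset)
  have "openin X (topspace X - X closure_of B)" "openin X (topspace X - X closure_of A)"
    by auto
  note * = perfectly_normal_map_open_cover[OF f this(1) y]
    perfectly_normal_map_open_cover[OF f this(2) y]
  obtain V1 U where V1: "openin Y V1" "y \<in> V1" and U: "\<And>l::nat. openin X (U l)"
    "(topspace X - X closure_of B) \<inter> pre X f V1 \<subseteq> (\<Union>l. U l)"
    "\<And>l. X closure_of U l \<inter> pre X f V1 \<subseteq> topspace X - X closure_of B"
    by (rule *(1)) (rule that)
  obtain V2 T where V2: "openin Y V2" "y \<in> V2" and T: "\<And>l::nat. openin X (T l)"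
    "(topspace X - X closure_of A) \<inter> pre X f V2 \<subseteq> (\<Union>l. T l)"
    "\<And>l. X closure_of T l \<inter> pre X f V2 \<subseteq> topspace X - X closure_of A"
    by (rule *(2)) (rule that)
  let ?P = "pre X f (V1 \<inter> V2)"
  have "A \<inter> ?P \<subseteq> (topspace X - X closure_of B) \<inter> pre X f V1"
    "B \<inter> ?P \<subseteq> (topspace X - X closure_of A) \<inter> pre X f V2"
    using sub by auto
  then have "A \<inter> ?P \<subseteq> (\<Union>l. U l)" "B \<inter> ?P \<subseteq> (\<Union>l. T l)"
    using U(2) T(2) by (meson subset_trans)+
  moreover have "disjnt (X closure_of U l) (B \<inter> ?P)" "disjnt (X closure_of T l) (A \<inter> ?P)" for l
    using subsetD[OF U(3)[of l]] subsetD[OF T(3)[of l]] subsetD[OF cl(1)] subsetD[OF cl(2)]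
    by (auto simp: disjnt_iff)
  ultimately obtain G H where "openin X G" "openin X H" "A \<inter> ?P \<subseteq> G" "B \<inter> ?P \<subseteq> H" "disjnt G H"
    by (rule countable_covers_separate[OF U(1) T(1)])
  moreover have "openin Y (V1 \<inter> V2)" "y \<in> V1 \<inter> V2"
    using V1 V2 by auto
  ultimately show ?thesis
    by (rule that[rotated 2])
qed

theorem theorem5p3:
  fixes X :: "'a topology" and Y :: "'b topology" and f :: "'a \<Rightarrow> 'b"
  assumes "perfectly_normal_map X Y f"
  shows "hereditarily_normal_map X Y f"
proof -
  have f: "continuous_map X Y f"
    using assms by (simp add: perfectly_normal_map_def)
  have "prenormal_map (subtopology (subtopology X S) (pre (subtopology X S) f W))
          (subtopology Y W) f" if S: "S \<subseteq> topspace X" and W: "openin Y W" for S W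
  proof -
    \<comment> \<open>Restricting first to \<open>S\<close> and then over \<open>W\<close> gives one subspace \<open>D\<close> of \<open>X\<close>, so
      it suffices to separate disjoint relatively closed subsets of \<open>D\<close>.\<close>
    define D where "D = S \<inter> pre X f W"
    have D: "D \<subseteq> topspace X" "f ` D \<subseteq> W"
      using S by (auto simp: D_def)
    have "S \<inter> pre (subtopology X S) f W = D"
      by (auto simp: D_def)
    then have XD: "subtopology (subtopology X S) (pre (subtopology X S) f W) = subtopology X D"
      by (simp add: subtopology_subtopology)
    have "prenormal_map (subtopology X D) (subtopology Y W) f"
      unfolding prenormal_map_def
    proof (intro conjI allI impI ballI)
      show "continuous_map (subtopology X D) (subtopology Y W) f"
        using f D by (auto simp: continuous_map_in_subtopology continuous_map_from_subtopology)
    next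
      fix A B y
      assume AB: "closedin (subtopology X D) A \<and> closedin (subtopology X D) B \<and> disjnt A B"
        and y: "y \<in> topspace (subtopology Y W)"
      have "separatedin (subtopology X D) A B"
        using AB by (simp add: separatedin_closed_sets)
      then have "separatedin X A B"
        by (simp add: separatedin_subtopology)
      moreover have "y \<in> topspace Y"
        using y by simp
      ultimately obtain V G H where V: "openin Y V" "y \<in> V" and GH: "openin X G" "openin X H"
        "A \<inter> pre X f V \<subseteq> G" "B \<inter> pre X f V \<subseteq> H" "disjnt G H"
        by (rule perfectly_normal_map_separatedin[OF assms])
      define Q where "Q = pre (subtopology X D) f (V \<inter> W)"
      have Q: "Q \<subseteq> D" "Q \<subseteq> pre X f V"
        by (auto simp: Q_def)
      have open_Q: "openin (subtopology (subtopology X D) Q) (K \<inter> Q)" if "openin X K" for K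
        using that Q(1)
        by (auto simp: subtopology_subtopology Int_absorb1 openin_subtopology)
      have "openin (subtopology Y W) (V \<inter> W)" "y \<in> V \<inter> W"
        using V y by (auto simp: openin_subtopology)
      moreover have "A \<inter> Q \<subseteq> G \<inter> Q" "B \<inter> Q \<subseteq> H \<inter> Q" "disjnt (G \<inter> Q) (H \<inter> Q)"
        using GH Q by (auto simp: disjnt_def)
      ultimately show "\<exists>V. openin (subtopology Y W) V \<and> y \<in> V \<and>
          (\<exists>G H. openin (subtopology (subtopology X D) (pre (subtopology X D) f V)) G \<and>
                 openin (subtopology (subtopology X D) (pre (subtopology X D) f V)) H \<and>
                 A \<inter> pre (subtopology X D) f V \<subseteq> G \<and> B \<inter> pre (subtopology X D) f V \<subseteq> H \<and>
                 disjnt G H)"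
        using open_Q[OF GH(1)] open_Q[OF GH(2)] unfolding Q_def by blast
    qed
    then show ?thesis by (simp only: XD)
  qed
  then show ?thesis
    using f by (auto simp: hereditarily_normal_map_def normal_map_def
        continuous_map_from_subtopology)
qed

end
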